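(* Let $\mathcal{A}=A\oplus P$ be a diolic algebra over $\mathbb{K}$ and let $\{\cdot,\cdot\}_{-1}$ be a Poisson bracket of degree $-1$ on $\mathcal{A}$. Let $\alpha:P\to D(A)$ be the map defined by $\alpha(p):=\{p,\cdot\}_{-1}|_A$. Then the triple $(\mathcal{A},\{\cdot,\cdot\}_{-1},\alpha)$ is a Lie algebroid; that is, $\alpha$ is an $A$-module homomorphism, and the $A$-module $P$ with the Lie bracket $[\cdot,\cdot]_P:=\{\cdot,\cdot\}_{-1}|_{P\times P}$ and anchor $\alpha$ is a Lie algebroid (Lie–Rinehart algebra) over $A$.
   Context: $\mathbb{K}$ is a field of characteristic $0$. A diolic algebra is a $\mathbb{Z}$-graded commutative $\mathbb{K}$-algebra $\mathcal{A}=\mathcal{A}_0\oplus\mathcal{A}_1$ with $\mathcal{A}_0=A$ a commutative unital $\mathbb{K}$-algebra, $\mathcal{A}_1=P$ an $A$-module, $\mathcal{A}_i=0$ for $i\ne 0,1$; the products are the multiplication of $A$, the module action $A\cdot P\subseteq P$, and $P\cdot P=0$. $D(A)$ is the $A$-module and Lie algebra of $\mathbb{K}$-linear derivations of $A$. A Poisson bracket of degree $g$ on a graded commutative algebra $\mathcal{A}$ is a $\mathbb{K}$-bilinear map with $\{\mathcal{A}_i,\mathcal{A}_j\}\subseteq\mathcal{A}_{i+j+g}$ which is a graded Lie bracket and a graded bi-derivation: for homogeneous $a,b,c$ (using the same letter for the degree in exponents) $\{a,b\}=-(-1)^{(a+g)(b+g)}\{b,a\}$, $\{a,\{b,c\}\}=\{\{a,b\},c\}+(-1)^{(a+g)(b+g)}\{b,\{a,c\}\}$,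 and $\{a,bc\}=\{a,b\}c+(-1)^{(a+g)b}b\{a,c\}$. A Lie algebroid structure on $P$ over $A$ (algebraically, a Lie–Rinehart algebra) consists of a $\mathbb{K}$-Lie bracket $[\cdot,\cdot]_P$ on $P$ and an $A$-linear map $\alpha:P\to D(A)$ which is a Lie algebra homomorphism, such that $[p,bq]_P=b[p,q]_P+\alpha(p)(b)q$ for $p,q\in P$, $b\in A$. *)

theory Defs
  imports Complex_Main "HOL-Library.Product_Plus"
begin

text \<open>
  The sort \<open>{comm_ring, comm_monoid_mult}\<close> describes commutative unital rings like
  \<open>comm_ring_1\<close>, but without the axiom \<open>0 \<noteq> 1\<close>, so that the zero algebra is
  not excluded. (The library locale \<open>module\<close> needs \<open>comm_ring_1\<close>; hence the module
  axioms are listed explicitly below.)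
\<close>

locale comm_unital_algebra = vector_space smA
  for smA :: "'k::field \<Rightarrow> 'a::{comm_ring, comm_monoid_mult} \<Rightarrow> 'a" +
  assumes smA_mult: "smA k (a * b) = smA k a * b"

text \<open>
  The \<open>\<K>\<close>-vector space structure of an \<open>A\<close>-module \<open>P\<close> is the one induced along
  \<open>\<K> \<rightarrow> A\<close>, \<open>k \<mapsto> k \<cdot> 1\<close>.
\<close>

definition induced_scale :: "('k \<Rightarrow> 'a::comm_monoid_mult \<Rightarrow> 'a) \<Rightarrow> ('a \<Rightarrow> 'p \<Rightarrow> 'p) \<Rightarrow> 'k \<Rightarrow> 'p \<Rightarrow> 'p"
  where "induced_scale smA act k p = act (smA k 1) p"

locale algebra_module = comm_unital_algebra smA
  for smA :: "'k::field \<Rightarrow> 'a::{comm_ring, comm_monoid_mult} \<Rightarrow> 'a" +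
  fixes act :: "'a \<Rightarrow> 'p::ab_group_add \<Rightarrow> 'p"
  assumes act_add_right: "act a (p + q) = act a p + act a q"
    and act_add_left: "act (a + b) p = act a p + act b p"
    and act_act: "act a (act b p) = act (a * b) p"
    and act_one: "act 1 p = p"

definition signed :: "int \<Rightarrow> 'x::ab_group_add \<Rightarrow> 'x"  \<comment> \<open>\<open>(-1)\<^sup>n x\<close>\<close>
  where "signed n x = (if even n then x else - x)"

locale graded_comm_algebra = vector_space scale
  for scale :: "'k::field \<Rightarrow> 'x::ab_group_add \<Rightarrow> 'x" +
  fixes mult :: "'x \<Rightarrow> 'x \<Rightarrow> 'x" and unit :: 'x and gr :: "int \<Rightarrow> 'x set"
  assumes mult_linear_right: "Vector_Spaces.linear scale scale (\<lambda>y. mult x y)"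
    and mult_linear_left: "Vector_Spaces.linear scale scale (\<lambda>x. mult x y)"
    and mult_assoc: "mult (mult x y) z = mult x (mult y z)"
    and mult_unit: "mult unit x = x"
    and gr_subspace: "subspace (gr i)"
    and gr_direct_sum:
      "\<exists>!f. (\<forall>i. f i \<in> gr i) \<and> finite {i. f i \<noteq> 0} \<and> x = (\<Sum>i\<in>{i. f i \<noteq> 0}. f i)"
    and gr_unit: "unit \<in> gr 0"
    and gr_mult: "\<lbrakk>x \<in> gr i; y \<in> gr j\<rbrakk> \<Longrightarrow> mult x y \<in> gr (i + j)"
    and graded_comm: "\<lbrakk>x \<in> gr i; y \<in> gr j\<rbrakk> \<Longrightarrow> mult x y = signed (i * j) (mult y x)"

locale graded_poisson = graded_comm_algebra scale mult unit gr
  for scale :: "'k::field \<Rightarrow> 'x::ab_group_add \<Rightarrow> 'x"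
    and mult :: "'x \<Rightarrow> 'x \<Rightarrow> 'x" and unit :: 'x and gr :: "int \<Rightarrow> 'x set" +
  fixes g :: int and br :: "'x \<Rightarrow> 'x \<Rightarrow> 'x"
  assumes br_linear_right: "Vector_Spaces.linear scale scale (\<lambda>y. br x y)"
    and br_linear_left: "Vector_Spaces.linear scale scale (\<lambda>x. br x y)"
    and br_degree: "\<lbrakk>x \<in> gr i; y \<in> gr j\<rbrakk> \<Longrightarrow> br x y \<in> gr (i + j + g)"
    and br_antisym: "\<lbrakk>x \<in> gr i; y \<in> gr j\<rbrakk> \<Longrightarrow>
      br x y = - signed ((i + g) * (j + g)) (br y x)"
    and br_jacobi: "\<lbrakk>x \<in> gr i; y \<in> gr j; z \<in> gr k\<rbrakk> \<Longrightarrow>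
      br x (br y z) = br (br x y) z + signed ((i + g) * (j + g)) (br y (br x z))"
    and br_leibniz: "\<lbrakk>x \<in> gr i; y \<in> gr j; z \<in> gr k\<rbrakk> \<Longrightarrow>
      br x (mult y z) = mult (br x y) z + signed ((i + g) * j) (mult y (br x z))"

text \<open>The diolic algebra \<open>A \<oplus> P\<close> is carried by the product type.\<close>

definition diolic_scale ::
  "('k \<Rightarrow> 'a::comm_monoid_mult \<Rightarrow> 'a) \<Rightarrow> ('a \<Rightarrow> 'p \<Rightarrow> 'p) \<Rightarrow> 'k \<Rightarrow> 'a \<times> 'p \<Rightarrow> 'a \<times> 'p"
  where "diolic_scale smA act k x = (smA k (fst x), induced_scale smA act k (snd x))"

definition diolic_mult ::
  "('a::times \<Rightarrow> 'p::ab_group_add \<Rightarrow> 'p) \<Rightarrow> 'a \<times> 'p \<Rightarrow> 'a \<times> 'p \<Rightarrow> 'a \<times> 'p"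
  where "diolic_mult act x y = (fst x * fst y, act (fst x) (snd y) + act (fst y) (snd x))"

definition diolic_unit :: "'a::one \<times> 'p::zero"
  where "diolic_unit = (1, 0)"

definition diolic_gr :: "int \<Rightarrow> ('a::zero \<times> 'p::zero) set"
  where "diolic_gr i =
    (if i = 0 then range (\<lambda>a. (a, 0)) else if i = 1 then range (\<lambda>p. (0, p)) else {(0, 0)})"

definition diolic_poisson ::
  "('k::field \<Rightarrow> 'a::{comm_ring, comm_monoid_mult} \<Rightarrow> 'a) \<Rightarrow> ('a \<Rightarrow> 'p::ab_group_add \<Rightarrow> 'p) \<Rightarrow>
    int \<Rightarrow> ('a \<times> 'p \<Rightarrow> 'a \<times> 'p \<Rightarrow> 'a \<times> 'p) \<Rightarrow> bool"
  where "diolic_poisson smA act g br \<longleftrightarrow>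
    graded_poisson (diolic_scale smA act) (diolic_mult act) diolic_unit diolic_gr g br"

text \<open>
  For a bracket of degree \<open>-1\<close> the projections below lose nothing; see
  \<open>diolic_poisson_restrict\<close>.
\<close>

definition diolic_anchor ::
  "('a::zero \<times> 'p::zero \<Rightarrow> 'a \<times> 'p \<Rightarrow> 'a \<times> 'p) \<Rightarrow> 'p \<Rightarrow> 'a \<Rightarrow> 'a"
  where "diolic_anchor br p = (\<lambda>a. fst (br (0, p) (a, 0)))"

definition diolic_bracket ::
  "('a::zero \<times> 'p::zero \<Rightarrow> 'a \<times> 'p \<Rightarrow> 'a \<times> 'p) \<Rightarrow> 'p \<Rightarrow> 'p \<Rightarrow> 'p"
  where "diolic_bracket br p q = snd (br (0, p) (0, q))"

definition derivations :: "('k::field \<Rightarrow> 'a::{comm_ring, comm_monoid_mult} \<Rightarrow> 'a) \<Rightarrow> ('a \<Rightarrow> 'a) set"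
  where "derivations smA =
    {d. Vector_Spaces.linear smA smA d \<and> (\<forall>a b. d (a * b) = d a * b + a * d b)}"

locale lie_algebra = vector_space scale
  for scale :: "'k::field \<Rightarrow> 'x::ab_group_add \<Rightarrow> 'x" +
  fixes lie :: "'x \<Rightarrow> 'x \<Rightarrow> 'x"
  assumes lie_linear_right: "Vector_Spaces.linear scale scale (\<lambda>y. lie x y)"
    and lie_linear_left: "Vector_Spaces.linear scale scale (\<lambda>x. lie x y)"
    and lie_alternating: "lie x x = 0"
    and lie_jacobi: "lie x (lie y z) + lie y (lie z x) + lie z (lie x y) = 0"

text \<open>
  The module structure and the Lie bracket on \<open>derivations smA\<close> are
  \<open>(a \<cdot> d) b = a * d b\<close> and the commutator \<open>[d, e] b = d (e b) - e (d b)\<close>.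
\<close>

locale lie_algebroid = algebra_module smA act + P: lie_algebra "induced_scale smA act" lie
  for smA :: "'k::field \<Rightarrow> 'a::{comm_ring, comm_monoid_mult} \<Rightarrow> 'a"
    and act :: "'a \<Rightarrow> 'p::ab_group_add \<Rightarrow> 'p"
    and lie :: "'p \<Rightarrow> 'p \<Rightarrow> 'p" +
  fixes anchor :: "'p \<Rightarrow> 'a \<Rightarrow> 'a"
  assumes anchor_derivation: "anchor p \<in> derivations smA"
    and anchor_add: "anchor (p + q) = (\<lambda>b. anchor p b + anchor q b)"
    and anchor_act: "anchor (act a p) = (\<lambda>b. a * anchor p b)"
    and anchor_lie: "anchor (lie p q) = (\<lambda>b. anchor p (anchor q b) - anchor q (anchor p b))"
    and lie_leibniz: "lie p (act b q) = act b (lie p q) + act (anchor p b) q"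


context algebra_module
begin

lemma act_zero_right [simp]: "act a 0 = 0"
  using act_add_right[of a 0 0] by simp

lemma act_zero_left [simp]: "act 0 p = 0"
  using act_add_left[of 0 0 p] by simp

lemma smA_eq: "smA k a = smA k 1 * a"
  using smA_mult[of k 1 a] by simp

lemma smA_mult_right: "smA k (a * b) = a * smA k b"
  by (metis mult.commute smA_mult)

lemma vector_space_induced: "vector_space (induced_scale smA act)"
  by unfold_locales
    (simp_all add: induced_scale_def act_add_right act_add_left act_act act_one
      scale_left_distrib smA_mult[symmetric])

lemma vector_space_diolic: "vector_space (diolic_scale smA act)"
proof -
  interpret P: vector_space "induced_scale smA act" by (rule vector_space_induced)
  show ?thesis
    by unfold_locales
      (auto simp: diolic_scale_def scale_right_distrib scale_left_distrib
        P.scale_right_distrib P.scale_left_distrib)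
qed

lemma diolic_direct_sum:
  fixes x :: "'a \<times> 'p"
  shows "\<exists>!f. (\<forall>i. f i \<in> diolic_gr i) \<and> finite {i::int. f i \<noteq> 0} \<and> x = (\<Sum>i\<in>{i. f i \<noteq> 0}. f i)"
proof -
  have sum_eq: "finite {i. f i \<noteq> 0} \<and> (\<Sum>i\<in>{i. f i \<noteq> 0}. f i) = f 0 + f 1"
    if f: "\<And>i. f i \<in> diolic_gr i" for f :: "int \<Rightarrow> 'a \<times> 'p"
  proof -
    have sub: "{i. f i \<noteq> 0} \<subseteq> {0, 1}"
    proof
      fix i assume "i \<in> {i. f i \<noteq> 0}"
      then show "i \<in> {0, 1}"
        using f[of i] by (auto simp: diolic_gr_def zero_prod_def split: if_splits)
    qed
    have "(\<Sum>i\<in>{i. f i \<noteq> 0}. f i) = (\<Sum>i\<in>{0, 1}. f i)"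
      by (rule sum.mono_neutral_left) (use sub in auto)
    moreover have "finite {i. f i \<noteq> 0}"
      by (rule finite_subset[OF sub]) simp
    ultimately show ?thesis by simp
  qed
  define F :: "int \<Rightarrow> 'a \<times> 'p" where
    "F = (\<lambda>i. if i = 0 then (fst x, 0) else if i = 1 then (0, snd x) else 0)"
  have F: "F i \<in> diolic_gr i" for i
    by (auto simp: F_def diolic_gr_def zero_prod_def)
  show ?thesis
  proof (rule ex1I[of _ F])
    show "(\<forall>i. F i \<in> diolic_gr i) \<and> finite {i. F i \<noteq> 0} \<and> x = (\<Sum>i\<in>{i. F i \<noteq> 0}. F i)"
      using F sum_eq[of F] by (simp add: F_def)
  next
    fix f :: "int \<Rightarrow> 'a \<times> 'p"
    assume *: "(\<forall>i. f i \<in> diolic_gr i) \<and> finite {i. f i \<noteq> 0} \<and> x = (\<Sum>i\<in>{i. f i \<noteq> 0}. f i)"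
    then have x: "x = f 0 + f 1" using sum_eq[of f] by simp
    obtain a p where "f 0 = (a, 0)" "f 1 = (0, p)"
      using *[THEN conjunct1, rule_format, of 0] *[THEN conjunct1, rule_format, of 1]
      by (auto simp: diolic_gr_def)
    moreover have "f i = 0" if "i \<noteq> 0" "i \<noteq> 1" for i
      using *[THEN conjunct1, rule_format, of i] that by (simp add: diolic_gr_def zero_prod_def)
    ultimately show "f = F"
      using x by (auto simp: F_def fun_eq_iff)
  qed
qed

theorem diolic_graded_comm_algebra:
  "graded_comm_algebra (diolic_scale smA act) (diolic_mult act) diolic_unit diolic_gr"
proof -
  interpret D: vector_space "diolic_scale smA act" by (rule vector_space_diolic)
  note simps = diolic_scale_def diolic_mult_def induced_scale_def diolic_unit_def diolic_gr_def
    act_add_right act_add_left act_act act_one algebra_simps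
  show ?thesis
  proof unfold_locales
    fix x y z :: "'a \<times> 'p" and k i j
    show "diolic_mult act x (y + z) = diolic_mult act x y + diolic_mult act x z"
      "diolic_mult act (y + z) x = diolic_mult act y x + diolic_mult act z x"
      by (simp_all add: simps)
    show "diolic_mult act x (diolic_scale smA act k y) = diolic_scale smA act k (diolic_mult act x y)"
      "diolic_mult act (diolic_scale smA act k y) x = diolic_scale smA act k (diolic_mult act y x)"
      using smA_eq[of k "fst y"] smA_eq[of k "fst x * fst y"] by (simp_all add: simps)
    show "diolic_mult act (diolic_mult act x y) z = diolic_mult act x (diolic_mult act y z)"
      "diolic_mult act diolic_unit x = x"
      by (simp_all add: simps)
    show "D.subspace (diolic_gr i)"
      unfolding D.subspace_def by (auto simp: simps zero_prod_def)
    show "diolic_unit \<in> (diolic_gr 0 :: ('a \<times> 'p) set)"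
      by (simp add: simps)
    show "\<exists>!f. (\<forall>i. f i \<in> diolic_gr i) \<and> finite {i. f i \<noteq> 0} \<and> x = (\<Sum>i\<in>{i. f i \<noteq> 0}. f i)"
      by (rule diolic_direct_sum)
    assume "x \<in> diolic_gr i" "y \<in> diolic_gr j"
    then show "diolic_mult act x y \<in> diolic_gr (i + j)"
      "diolic_mult act x y = signed (i * j) (diolic_mult act y x)"
      by (auto simp: simps signed_def zero_prod_def split: if_splits)
  qed
qed

end

lemma diolic_poisson_restrict:
  assumes "diolic_poisson smA act (-1) br"
  shows "br (0, p) (a, 0) = (diolic_anchor br p a, 0)"
    and "br (0, p) (0, q) = (0, diolic_bracket br p q)"
proof -
  interpret graded_poisson "diolic_scale smA act" "diolic_mult act" diolic_unit diolic_gr "-1" br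
    using assms by (simp add: diolic_poisson_def)
  show "br (0, p) (a, 0) = (diolic_anchor br p a, 0)"
    using br_degree[of "(0, p)" 1 "(a, 0)" 0] by (auto simp: diolic_gr_def diolic_anchor_def)
  show "br (0, p) (0, q) = (0, diolic_bracket br p q)"
    using br_degree[of "(0, p)" 1 "(0, q)" 1] by (auto simp: diolic_gr_def diolic_bracket_def)
qed

end

theory Submission
  imports Defs
begin

text \<open>
  In degree \<open>-1\<close> the sign exponents of the Poisson axioms are built from shifted degrees:
  \<open>P\<close> sits in shifted degree \<open>0\<close> and \<open>A\<close> in shifted degree \<open>-1\<close>. The axioms for a bracket
  \<open>{p, _}\<close> with \<open>p\<close> in \<open>P\<close> therefore carry no sign, so that \<open>{p, _}\<close> is an ordinary
  derivation and the bracket on \<open>P\<close> is an ordinary Lie bracket. The axioms of a Lie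
  algebroid are components of the Poisson axioms: the Jacobi identity on \<open>P, P, P\<close> and on
  \<open>P, P, A\<close> gives the Jacobi identity of \<open>P\<close> and the homomorphism property of the anchor,
  and the Leibniz rule for \<open>{p, ab}\<close> and \<open>{p, bq}\<close> gives the derivation property of the
  anchor and the Leibniz rule of \<open>P\<close>.

  Two axioms need an additional idea. The anchor is \<open>A\<close>-linear (\<open>anchor_act\<close>) because
  \<open>{A, A}\<close> lies in degree \<open>-1\<close>, where the diolic algebra vanishes. The bracket is alternating
  (\<open>bracket_self\<close>) because an antisymmetric bilinear map is alternating in
  characteristic \<open>0\<close>.
\<close>

locale diolic_poisson_minus_one = algebra_module smA act
  for smA :: "'k::field \<Rightarrow> 'a::{comm_ring, comm_monoid_mult} \<Rightarrow> 'a"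
    and act :: "'a \<Rightarrow> 'p::ab_group_add \<Rightarrow> 'p" +
  fixes br :: "'a \<times> 'p \<Rightarrow> 'a \<times> 'p \<Rightarrow> 'a \<times> 'p"
  assumes poisson: "diolic_poisson smA act (-1) br"
begin

sublocale Q: graded_poisson "diolic_scale smA act" "diolic_mult act" diolic_unit diolic_gr "-1" br
  using poisson by (simp add: diolic_poisson_def)

sublocale P: vector_space "induced_scale smA act"
  by (rule vector_space_induced)

abbreviation anchor where "anchor \<equiv> diolic_anchor br"
abbreviation lie where "lie \<equiv> diolic_bracket br"

lemmas br_PA = diolic_poisson_restrict(1)[OF poisson]
lemmas br_PP = diolic_poisson_restrict(2)[OF poisson]

lemma in_gr [simp]: "(a, 0) \<in> diolic_gr 0" "(0, p) \<in> diolic_gr 1"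
  by (auto simp: diolic_gr_def)

lemmas br_linear_simps =
  module_hom.add[OF Q.br_linear_right[unfolded linear_iff_module_hom]]
  module_hom.add[OF Q.br_linear_left[unfolded linear_iff_module_hom]]
  module_hom.scale[OF Q.br_linear_right[unfolded linear_iff_module_hom]]
  module_hom.scale[OF Q.br_linear_left[unfolded linear_iff_module_hom]]

lemma anchor_add_right: "anchor p (a + b) = anchor p a + anchor p b"
  using br_linear_simps(1)[of "(0, p)" "(a, 0)" "(b, 0)"] by (simp add: br_PA)

lemma anchor_scale_right: "anchor p (smA k a) = smA k (anchor p a)"
  using br_linear_simps(3)[of "(0, p)" k "(a, 0)"]
  by (simp add: br_PA diolic_scale_def induced_scale_def)

lemma anchor_mult: "anchor p (a * b) = anchor p a * b + a * anchor p b"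
  using Q.br_leibniz[of "(0, p)" 1 "(a, 0)" 0 "(b, 0)" 0]
  by (simp add: br_PA diolic_mult_def signed_def)

lemma anchor_derivation: "anchor p \<in> derivations smA"
proof -
  have "Vector_Spaces.linear smA smA (anchor p)"
    by unfold_locales (simp_all add: anchor_add_right anchor_scale_right)
  then show ?thesis
    by (simp add: derivations_def anchor_mult)
qed

lemma anchor_add_left: "anchor (p + q) b = anchor p b + anchor q b"
  using br_linear_simps(2)[of "(0, p)" "(0, q)" "(b, 0)"] by (simp add: br_PA)

lemma br_AA: "br (a, 0) (b, 0) = 0"
  using Q.br_degree[of "(a, 0)" 0 "(b, 0)" 0] by (simp add: diolic_gr_def zero_prod_def)

lemma br_AP: "br (a, 0) (0, p) = (- anchor p a, 0)"
  using Q.br_antisym[of "(a, 0)" 0 "(0, p)" 1] by (simp add: br_PA signed_def)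

text \<open>
  The Leibniz rule acts on the second bracket entry only. Antisymmetry moves \<open>a p\<close> there, and
  in \<open>{b, a p} = {b, a} p + a {b, p}\<close> the first summand vanishes for degree reasons.
\<close>

lemma anchor_act: "anchor (act a p) b = a * anchor p b"
  using Q.br_leibniz[of "(b, 0)" 0 "(a, 0)" 0 "(0, p)" 1]
  by (simp add: br_AA br_AP diolic_mult_def signed_def)

lemma anchor_lie: "anchor (lie p q) b = anchor p (anchor q b) - anchor q (anchor p b)"
  using Q.br_jacobi[of "(0, p)" 1 "(0, q)" 1 "(b, 0)" 0]
  by (simp add: br_PA br_PP signed_def)

lemma lie_act: "lie p (act b q) = act b (lie p q) + act (anchor p b) q"
  using Q.br_leibniz[of "(0, p)" 1 "(b, 0)" 0 "(0, q)" 1]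
  by (simp add: br_PA br_PP diolic_mult_def signed_def add.commute)

lemma lie_linear_right: "Vector_Spaces.linear (induced_scale smA act) (induced_scale smA act) (\<lambda>q. lie p q)"
proof unfold_locales
  fix q r k
  show "lie p (q + r) = lie p q + lie p r"
    using br_linear_simps(1)[of "(0, p)" "(0, q)" "(0, r)"] by (simp add: br_PP)
  show "lie p (induced_scale smA act k q) = induced_scale smA act k (lie p q)"
    using br_linear_simps(3)[of "(0, p)" k "(0, q)"] by (simp add: br_PP diolic_scale_def)
qed

lemma lie_linear_left: "Vector_Spaces.linear (induced_scale smA act) (induced_scale smA act) (\<lambda>p. lie p q)"
proof unfold_locales
  fix p r k
  show "lie (p + r) q = lie p q + lie r q"
    using br_linear_simps(2)[of "(0, p)" "(0, r)" "(0, q)"] by (simp add: br_PP)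
  show "lie (induced_scale smA act k p) q = induced_scale smA act k (lie p q)"
    using br_linear_simps(4)[of k "(0, p)" "(0, q)"] by (simp add: br_PP diolic_scale_def)
qed

lemma lie_antisym: "lie p q = - lie q p"
  using Q.br_antisym[of "(0, p)" 1 "(0, q)" 1] by (simp add: br_PP signed_def)

lemma lie_jacobi: "lie p (lie q r) + lie q (lie r p) + lie r (lie p q) = 0"
proof -
  have "lie p (lie q r) = lie (lie p q) r + lie q (lie p r)"
    using Q.br_jacobi[of "(0, p)" 1 "(0, q)" 1 "(0, r)" 1] by (simp add: br_PP signed_def)
  moreover have "lie (lie p q) r = - lie r (lie p q)"
    by (rule lie_antisym)
  moreover have "lie q (lie p r) = - lie q (lie r p)"
    using module_hom.neg[OF lie_linear_right[unfolded linear_iff_module_hom], of q "lie r p"] lie_antisym[of p r] by simp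
  ultimately show ?thesis
    by simp
qed

text \<open>
  Antisymmetry only yields \<open>2 {p, p} = 0\<close>, so here \<open>2\<close> has to be invertible in \<open>\<K>\<close>.
\<close>

lemma bracket_self:
  assumes "(2::'k) \<noteq> 0"
  shows "lie p p = 0"
proof -
  have "induced_scale smA act 2 (lie p p) = lie p p + lie p p"
    using P.scale_left_distrib[of 1 1 "lie p p"] by simp
  also have "\<dots> = 0"
    using lie_antisym[of p p] by (simp add: eq_neg_iff_add_eq_0)
  finally show ?thesis
    using assms by simp
qed

end

theorem lemma27:
  fixes smA :: "'k::field_char_0 \<Rightarrow> 'a::{comm_ring, comm_monoid_mult} \<Rightarrow> 'a"
    and act :: "'a \<Rightarrow> 'p::ab_group_add \<Rightarrow> 'p"
    and br :: "'a \<times> 'p \<Rightarrow> 'a \<times> 'p \<Rightarrow> 'a \<times> 'p"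
  assumes "algebra_module smA act"
    and "diolic_poisson smA act (-1) br"
  shows "lie_algebroid smA act (diolic_bracket br) (diolic_anchor br)"
proof -
  interpret diolic_poisson_minus_one smA act br
    using assms by (simp add: diolic_poisson_minus_one_def diolic_poisson_minus_one_axioms_def)
  show ?thesis
  proof (intro lie_algebroid.intro lie_algebra.intro lie_algebra_axioms.intro
      lie_algebroid_axioms.intro)
    show "algebra_module smA act"
      by (rule assms)
    show "vector_space (induced_scale smA act)"
      by (rule vector_space_induced)
    show "lie p p = 0" for p
      by (rule bracket_self) simp
  qed (auto intro: anchor_derivation lie_linear_right lie_linear_left
      simp: fun_eq_iff anchor_add_left anchor_act anchor_lie lie_act lie_jacobi)
qed

end
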